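(* Consider a tenable balanced affine two-colour urn with multiple drawings, with $T_0+m(a_{m-1}-a_m)>0$. Let $$g_n=\prod_{j=0}^{n-1}\frac{T_j}{T_j+m(a_{m-1}-a_m)}=\frac{\Gamma(n+\frac{T_0}\sigma)\,\Gamma(\frac{T_0+m(a_{m-1}-a_m)}\sigma)}{\Gamma(\frac{T_0}\sigma)\,\Gamma(n+\frac{T_0+m(a_{m-1}-a_m)}\sigma)} .$$ For both sampling models $\mathcal M$ and $\mathcal R$, $$\mathbb E[W_n]=\frac{a_m}{g_n}\sum_{j=1}^n g_j+\frac{W_0}{g_n}.$$ If $\frac{m(a_{m-1}-a_m)}{\sigma}<1$, then $$\mathbb E[W_n]=\frac{a_m(n+\frac{T_0}\sigma)}{1-\frac{m(a_{m-1}-a_m)}\sigma}+\Big(W_0-\frac{\frac{a_mT_0}\sigma}{1-\frac{m(a_{m-1}-a_m)}\sigma}\Big)\frac{\binom{n-1+\frac{T_0+m(a_{m-1}-a_m)}\sigma}{n}}{\binom{n-1+\frac{T_0}\sigma}{n}},$$ and, as $n\to\infty$, $$\mathbb E[W_n]=\frac{a_m\sigma}{\sigma-m(a_{m-1}-a_m)}\,n+\Big(W_0-\frac{\frac{a_mT_0}\sigma}{1-\frac{m(a_{m-1}-a_m)}\sigma}\Big)\frac{\Gamma(\frac{T_0}\sigma)}{\Gamma(\frac{T_0+m(a_{m-1}-a_m)}\sigma)}\,n^{\frac{m(a_{m-1}-a_m)}\sigma}+\mathcal O(1).$$ If $\frac{m(a_{m-1}-a_m)}\sigma=1$, then $\mathbb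 E[W_n]=W_0\frac{n\sigma+T_0}{T_0}$.
   Context: Urn setting. Let $m\ge1$ be an integer (sample size), and let $a_k,b_k$ ($0\le k\le m$) be integers with $a_k+b_k=\sigma$ for all $k$ (the urn is balanced), where $\sigma\ge1$. The urn starts with $W_0,B_0\in\mathbb N_0$ white and black balls, $T_0=W_0+B_0\ge m$. At step $n\ge1$ a sample of $m$ balls is drawn from the urn, which contains $W_{n-1}$ white and $B_{n-1}$ black balls; the sample is returned, and if it contained $k$ white and $m-k$ black balls, then $a_{m-k}$ white and $b_{m-k}$ black balls are added (negative numbers mean removal). Thus $T_n=W_n+B_n=T_0+\sigma n$. $\mathbb F_n$ is the $\sigma$-field generated by the first $n$ draws. Sampling models. Given $\mathbb F_{n-1}$, the probability that the $n$-th sample contains exactly $k$ white balls ($0\le k\le m$) is $\binom{W_{n-1}}{k}\binom{T_{n-1}-W_{n-1}}{m-k}\big/\binom{T_{n-1}}{m}$ in model $\mathcal M$ (without replacement) and $\binom mk W_{n-1}^k(T_{n-1}-W_{n-1})^{m-k}/T_{n-1}^m$ in model $\mathcal R$ (with replacement). Tenability: in model $\mathcal M$, $a_k\ge-(m-k)$ and $b_k\ge -k$ for $0\le k\le m$; in model $\mathcal R$, $a_k\ge-1$ for $0\le k\le m-1$, $a_m\ge0$, $b_k\ge-1$ for $1\le k\le m$, $b_0\ge0$. Affine urn: $a_k=(m-k)a_{m-1}-(m-k-1)a_m$ for $0\le k\le m$. Generalized binomial coefficients: $\binom{x}{n}=x(x-1)\cdots(x-n+1)/n!$. *)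

theory Defs
  imports "HOL-Probability.Probability" "HOL-Library.Landau_Symbols"
begin

datatype sampling_model = Without_Replacement | With_Replacement

text \<open>
  Probability that a sample of \<open>m\<close> balls from an urn with \<open>w\<close> white balls among \<open>t\<close> balls has
  exactly \<open>k\<close> white balls. Ball counts are integers because replacement entries may be negative;
  at integers \<open>x \<ge> 0\<close> the generalized coefficient \<open>x gchoose k\<close> is the ordinary binomial
  coefficient, and tenable urns have \<open>0 \<le> w \<le> t\<close> almost surely.
\<close>

fun draw_prob :: "sampling_model \<Rightarrow> nat \<Rightarrow> int \<Rightarrow> int \<Rightarrow> nat \<Rightarrow> real" where
  "draw_prob Without_Replacement m t w k =
     (real_of_int w gchoose k) * (real_of_int (t - w) gchoose (m - k)) / (real_of_int t gchoose m)"
| "draw_prob With_Replacement m t w k =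
     real (m choose k) * real_of_int w ^ k * real_of_int (t - w) ^ (m - k) / real_of_int t ^ m"

definition balanced_urn :: "nat \<Rightarrow> (nat \<Rightarrow> int) \<Rightarrow> (nat \<Rightarrow> int) \<Rightarrow> int \<Rightarrow> bool" where
  "balanced_urn m a b \<sigma> \<longleftrightarrow> (\<forall>k\<le>m. a k + b k = \<sigma>)"

fun tenable_urn :: "sampling_model \<Rightarrow> nat \<Rightarrow> (nat \<Rightarrow> int) \<Rightarrow> (nat \<Rightarrow> int) \<Rightarrow> bool" where
  "tenable_urn Without_Replacement m a b \<longleftrightarrow>
     (\<forall>k\<le>m. a k \<ge> - (int m - int k) \<and> b k \<ge> - int k)"
| "tenable_urn With_Replacement m a b \<longleftrightarrow>
     (\<forall>k<m. a k \<ge> -1) \<and> a m \<ge> 0 \<and> (\<forall>k\<in>{1..m}. b k \<ge> -1) \<and> b 0 \<ge> 0"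

definition affine_urn :: "nat \<Rightarrow> (nat \<Rightarrow> int) \<Rightarrow> bool" where
  "affine_urn m a \<longleftrightarrow>
     (\<forall>k\<le>m. a k = (int m - int k) * a (m - 1) - (int m - int k - 1) * a m)"

text \<open>
  \<open>X i \<omega>\<close> is the number of white balls in the \<open>i\<close>-th sample, \<open>i \<ge> 1\<close> (\<open>X 0\<close> is not used).
  A sample with \<open>k\<close> white balls adds \<open>c (m - k)\<close> balls of the colour with replacement sequence \<open>c\<close>
  (\<open>a\<close> for white, \<open>b\<close> for black) and initial number \<open>c0\<close>.
\<close>

definition ball_count ::
  "nat \<Rightarrow> (nat \<Rightarrow> int) \<Rightarrow> nat \<Rightarrow> (nat \<Rightarrow> 'w \<Rightarrow> nat) \<Rightarrow> nat \<Rightarrow> 'w \<Rightarrow> int" where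
  "ball_count m c c0 X n \<omega> = int c0 + (\<Sum>i=1..n. c (m - X i \<omega>))"

definition draw_history :: "'w measure \<Rightarrow> (nat \<Rightarrow> 'w \<Rightarrow> nat) \<Rightarrow> nat \<Rightarrow> 'w measure" where
  "draw_history M X n = sigma (space M) {X i -` A \<inter> space M | i A. i \<in> {1..n}}"

locale urn_process = prob_space M
  for M :: "'w measure" +
  fixes model :: sampling_model
    and m :: nat
    and a b :: "nat \<Rightarrow> int"
    and W0 B0 :: nat
    and X :: "nat \<Rightarrow> 'w \<Rightarrow> nat"
  assumes draw_measurable: "X n \<in> measurable M (count_space UNIV)"
    and draw_le: "n \<ge> 1 \<Longrightarrow> \<omega> \<in> space M \<Longrightarrow> X n \<omega> \<le> m"
    and draw_cond_prob: "n \<ge> 1 \<Longrightarrow> k \<le> m \<Longrightarrow>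
      AE \<omega> in M. real_cond_exp M (draw_history M X (n - 1)) (indicator {\<omega>' \<in> space M. X n \<omega>' = k}) \<omega>
        = draw_prob model m
            (ball_count m a W0 X (n - 1) \<omega> + ball_count m b B0 X (n - 1) \<omega>)
            (ball_count m a W0 X (n - 1) \<omega>) k"

text \<open>Here \<open>T0 + \<sigma> * j\<close> is the total number of balls after \<open>j\<close> steps of a balanced urn, and \<open>\<mu>\<close>
  stands for \<open>m (a (m - 1) - a m)\<close>.\<close>

definition urn_g :: "real \<Rightarrow> real \<Rightarrow> real \<Rightarrow> nat \<Rightarrow> real" where
  "urn_g T0 \<sigma> \<mu> n = (\<Prod>j<n. (T0 + \<sigma> * real j) / (T0 + \<sigma> * real j + \<mu>))"

end

theory Submission
  imports
    Defs
    "HOL-Real_Asymp.Real_Asymp"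
begin

text \<open>
  For an affine urn \<open>a (m - k)\<close> is an affine function of \<open>k\<close>, and in both models a sample contains
  \<open>m w / t\<close> white balls on average, so the mean satisfies the linear recurrence
  \<open>E (n + 1) = a m + (1 + \<mu> / (T0 + \<sigma> n)) E n\<close> with integrating factor \<open>g\<close>. For
  \<open>\<mu> < \<sigma>\<close> it has the particular solution \<open>c (n + T0 / \<sigma>)\<close>, and the error term is
  governed by \<open>1 / g n\<close>, which is a constant times \<open>\<Gamma> (y + \<lambda>) / \<Gamma> y\<close> with
  \<open>y = n + T0 / \<sigma>\<close> and \<open>\<lambda> = \<mu> / \<sigma>\<close>. For \<open>\<mu> = \<sigma>\<close>,
  balance gives \<open>b 0 = - a m\<close>, so tenability forces \<open>a m = 0\<close>.
\<close>

subsection \<open>Moments of a single draw\<close>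

text \<open>This is the unnormalised mean of the hypergeometric law. Absorption
  \<open>k * (x gchoose k) = x * ((x - 1) gchoose (k - 1))\<close> reduces the sum to Vandermonde,
  and absorption at \<open>x + y\<close> restores the lower index \<open>m\<close>.\<close>

lemma sum_index_gbinomial_Vandermonde:
  fixes x y :: real
  assumes "m \<ge> 1"
  shows "(x + y) * (\<Sum>k\<le>m. real k * ((x gchoose k) * (y gchoose (m - k))))
    = real m * x * ((x + y) gchoose m)"
proof -
  obtain l where l: "m = Suc l"
    using assms by (cases m) auto
  \<comment> \<open>The term \<open>k = 0\<close> vanishes; the shift brings the rest into the form
    that absorption requires.\<close>
  have "(\<Sum>k\<le>m. real k * ((x gchoose k) * (y gchoose (m - k))))
      = (\<Sum>k\<le>l. real (Suc k) * (x gchoose Suc k) * (y gchoose (l - k)))"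
    unfolding l by (subst sum.atMost_Suc_shift) (simp add: mult.assoc)
  also have "\<dots> = x * (\<Sum>k\<le>l. ((x - 1) gchoose k) * (y gchoose (l - k)))"
    unfolding gbinomial_absorption sum_distrib_left by (simp add: mult.assoc)
  also have "\<dots> = x * ((x + y - 1) gchoose l)"
    using gbinomial_Vandermonde[of "x - 1" y l] by (simp add: atLeast0AtMost algebra_simps)
  finally show ?thesis
    using gbinomial_absorption[of l "x + y"] unfolding l by (simp add: mult_ac)
qed

text \<open>The counterpart for drawing with replacement: absorption again, with the binomial
  theorem in place of Vandermonde.\<close>

lemma sum_index_binomial:
  fixes x y :: real
  assumes "m \<ge> 1"
  shows "(\<Sum>k\<le>m. real k * (real (m choose k) * x ^ k * y ^ (m - k)))
    = real m * x * (x + y) ^ (m - 1)"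
proof -
  obtain l where l: "m = Suc l"
    using assms by (cases m) auto
  have absorb: "real (Suc k) * real (Suc l choose Suc k) = real m * real (l choose k)" for k
    using Suc_times_binomial_eq[of l k] unfolding l by (metis mult.commute of_nat_mult)
  have "(\<Sum>k\<le>m. real k * (real (m choose k) * x ^ k * y ^ (m - k)))
      = (\<Sum>k\<le>l. (real (Suc k) * real (Suc l choose Suc k)) * (x ^ Suc k * y ^ (l - k)))"
    unfolding l by (subst sum.atMost_Suc_shift)
      (simp add: mult.assoc del: of_nat_Suc binomial_Suc_Suc)
  also have "\<dots> = real m * x * (\<Sum>k\<le>l. real (l choose k) * x ^ k * y ^ (l - k))"
    unfolding absorb sum_distrib_left by (simp add: mult_ac)
  finally show ?thesis
    by (simp add: l binomial_ring)
qed

text \<open>The zeroth and first moments come from polynomial identities in \<open>w\<close>, so the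
  formula applies at every outcome, whatever the white count. The bound \<open>t \<ge> int m\<close>
  keeps the denominators positive.\<close>

lemma draw_prob_affine_mean:
  assumes "m \<ge> 1" and "t \<ge> int m"
  shows "(\<Sum>k\<le>m. (\<alpha> + \<beta> * real k) * draw_prob model m t w k)
    = \<alpha> + \<beta> * (real m * real_of_int w / real_of_int t)"
proof -
  have t: "real_of_int t > 0"
    using assms by simp
  have moments: "(\<Sum>k\<le>m. draw_prob model m t w k) = 1 \<and>
      (\<Sum>k\<le>m. real k * draw_prob model m t w k) = real m * real_of_int w / real_of_int t"
  proof (cases model)
    case Without_Replacement
    have t_eq: "real_of_int t = real (nat t)"
      using assms by simp
    have pos: "real_of_int t gchoose m > 0"
      unfolding t_eq binomial_gbinomial[symmetric] using assms by simp
    have "(\<Sum>k\<le>m. (real_of_int w gchoose k) * (real_of_int (t - w) gchoose (m - k)))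
        = real_of_int t gchoose m"
      using gbinomial_Vandermonde[of "real_of_int w" "real_of_int (t - w)" m]
      by (simp add: atLeast0AtMost)
    moreover have "real_of_int t *
        (\<Sum>k\<le>m. real k * ((real_of_int w gchoose k) * (real_of_int (t - w) gchoose (m - k))))
        = real m * real_of_int w * (real_of_int t gchoose m)"
      using sum_index_gbinomial_Vandermonde[OF assms(1), of "real_of_int w" "real_of_int (t - w)"]
      by simp
    ultimately show ?thesis
      using t pos Without_Replacement
      by (simp add: sum_divide_distrib[symmetric] field_simps)
  next
    case With_Replacement
    have "(\<Sum>k\<le>m. real (m choose k) * real_of_int w ^ k * real_of_int (t - w) ^ (m - k))
        = real_of_int t ^ m"
      using binomial_ring[of "real_of_int w" "real_of_int (t - w)" m] by simp
    moreover have
      "(\<Sum>k\<le>m. real k * (real (m choose k) * real_of_int w ^ k * real_of_int (t - w) ^ (m - k)))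
        = real m * real_of_int w * real_of_int t ^ (m - 1)"
      using sum_index_binomial[OF assms(1), of "real_of_int w" "real_of_int (t - w)"] by simp
    moreover have "real_of_int t ^ m = real_of_int t * real_of_int t ^ (m - 1)"
      using assms(1) by (cases m) auto
    ultimately show ?thesis
      using t With_Replacement
      by (simp add: sum_divide_distrib[symmetric] field_simps)
  qed
  have "(\<Sum>k\<le>m. (\<alpha> + \<beta> * real k) * draw_prob model m t w k)
      = \<alpha> * (\<Sum>k\<le>m. draw_prob model m t w k)
        + \<beta> * (\<Sum>k\<le>m. real k * draw_prob model m t w k)"
    by (simp add: sum_distrib_left sum.distrib[symmetric] algebra_simps)
  then show ?thesis
    using moments by simp
qed

subsection \<open>The recurrence for the mean\<close>

text \<open>A sample with \<open>k\<close> white balls adds \<open>a (m - k)\<close> white ones.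
  Since this is affine in \<open>k\<close>, its mean depends only on the mean of the draw.\<close>

lemma affine_urn_reflect:
  assumes "affine_urn m a" and "k \<le> m"
  shows "a (m - k) = a m + (a (m - 1) - a m) * int k"
proof -
  have "a (m - k) = (int m - int (m - k)) * a (m - 1) - (int m - int (m - k) - 1) * a m"
    using assms(1) unfolding affine_urn_def by (meson diff_le_self)
  then show ?thesis
    using assms(2) by (simp add: of_nat_diff algebra_simps)
qed

lemma ball_count_Suc:
  "ball_count m c c0 X (Suc n) \<omega> = ball_count m c c0 X n \<omega> + c (m - X (Suc n) \<omega>)"
  by (simp add: ball_count_def)

lemma ball_count_balanced:
  assumes "balanced_urn m a b \<sigma>"
  shows "ball_count m a W0 X n \<omega> + ball_count m b B0 X n \<omega> = int (W0 + B0) + \<sigma> * int n"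
proof -
  have "a (m - j) + b (m - j) = \<sigma>" for j
    using assms unfolding balanced_urn_def by simp
  then show ?thesis
    by (induction n) (simp_all add: ball_count_Suc algebra_simps, simp add: ball_count_def)
qed

context urn_process
begin

lemma simple_function_draw:
  assumes "n \<ge> 1"
  shows "simple_function M (X n)"
  unfolding simple_function_def
proof (intro conjI ballI)
  show "finite (X n ` space M)"
    by (rule finite_subset[of _ "{..m}"]) (use draw_le[OF assms] in auto)
  show "X n -` {x} \<inter> space M \<in> sets M" for x
    using measurable_sets[OF draw_measurable[of n], of "{x}"] by simp
qed

text \<open>A count depends on finitely many draws with values in \<open>{..m}\<close>, so it has
  finite range, and every real function of it is integrable.\<close>

lemma simple_function_ball_count: "simple_function M (ball_count m c c0 X n)"
proof (induction n)
  case 0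
  have "ball_count m c c0 X 0 = (\<lambda>_. int c0)"
    by (simp add: fun_eq_iff ball_count_def)
  then show ?case
    by simp
next
  case (Suc n)
  have "ball_count m c c0 X (Suc n) = (\<lambda>\<omega>. ball_count m c c0 X n \<omega> + c (m - X (Suc n) \<omega>))"
    by (simp add: fun_eq_iff ball_count_Suc)
  then show ?case
    using simple_function_compose2[OF Suc simple_function_draw[of "Suc n"], of "\<lambda>x y. x + c (m - y)"]
    by simp
qed

lemma integrable_simple_real:
  fixes f :: "'w \<Rightarrow> real"
  assumes "simple_function M f"
  shows "integrable M f"
  using assms by (intro integrable_simple_function) auto

lemma integrable_of_ball_count:
  "integrable M (\<lambda>\<omega>. (h :: int \<Rightarrow> real) (ball_count m c c0 X n \<omega>))"
  by (rule integrable_simple_real[OF simple_function_compose1[OF simple_function_ball_count]])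

lemma subalgebra_draw_history: "subalgebra M (draw_history M X n)"
proof -
  let ?G = "{X i -` A \<inter> space M |i A. i \<in> {1..n}}"
  have "?G \<subseteq> sets M"
    using measurable_sets[OF draw_measurable] by auto
  then have "sigma_sets (space M) ?G \<subseteq> sets M"
    by (rule sets.sigma_sets_subset)
  moreover have "?G \<subseteq> Pow (space M)"
    by blast
  ultimately show ?thesis
    unfolding subalgebra_def draw_history_def by (simp add: space_measure_of sets_measure_of)
qed

text \<open>Conditional expectation preserves the mean, so integrating the conditional law gives the
  unconditional one. Balance makes the total deterministic, which leaves the white count as the only
  random argument.\<close>

lemma draw_total_prob:
  assumes "balanced_urn m a b \<sigma>" and "k \<le> m"
  shows "prob {\<omega> \<in> space M. X (Suc n) \<omega> = k}
    = expectation (\<lambda>\<omega>. draw_prob model m (int (W0 + B0) + \<sigma> * int n) (ball_count m a W0 X n \<omega>) k)"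
proof -
  interpret finite_measure_subalgebra M "draw_history M X n"
    by unfold_locales (rule subalgebra_draw_history)
  let ?A = "{\<omega> \<in> space M. X (Suc n) \<omega> = k}"
  let ?p = "\<lambda>\<omega>. draw_prob model m (int (W0 + B0) + \<sigma> * int n) (ball_count m a W0 X n \<omega>) k"
  have A: "?A \<in> sets M"
    using measurable_sets[OF draw_measurable[of "Suc n"], of "{k}"]
    by (simp add: vimage_def Int_def conj_commute)
  then have int: "integrable M (indicator ?A :: 'w \<Rightarrow> real)"
    by (intro integrable_real_indicator) (auto simp: emeasure_finite less_top[symmetric])
  have p: "integrable M ?p"
    by (rule integrable_of_ball_count)
  have "AE \<omega> in M. real_cond_exp M (draw_history M X n) (indicator ?A) \<omega> = ?p \<omega>"
    using draw_cond_prob[of "Suc n" k] assms(2) unfolding ball_count_balanced[OF assms(1)] by simp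
  then have "expectation (real_cond_exp M (draw_history M X n) (indicator ?A)) = expectation ?p"
    using p real_cond_exp_int(1)[OF int] by (intro integral_cong_AE) auto
  then show ?thesis
    using real_cond_exp_int(2)[OF int] A by (simp add: sets.Int_space_eq2)
qed

text \<open>By linearity the increment enters only through the marginal law of the next draw, which
  \<open>draw_total_prob\<close> expresses through the current white count.\<close>

lemma expectation_ball_count_Suc:
  assumes "m \<ge> 1" and "\<sigma> \<ge> 1" and "W0 + B0 \<ge> m"
    and "balanced_urn m a b \<sigma>" and "affine_urn m a"
  shows "expectation (\<lambda>\<omega>. real_of_int (ball_count m a W0 X (Suc n) \<omega>))
    = real_of_int (a m) + (1 + real m * real_of_int (a (m - 1) - a m)
        / (real (W0 + B0) + real_of_int \<sigma> * real n))
      * expectation (\<lambda>\<omega>. real_of_int (ball_count m a W0 X n \<omega>))"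
proof -
  define t where "t = int (W0 + B0) + \<sigma> * int n"
  define \<beta> where "\<beta> = real_of_int (a (m - 1) - a m)"
  let ?W = "\<lambda>\<omega>. ball_count m a W0 X n \<omega>"
  let ?A = "\<lambda>k. {\<omega> \<in> space M. X (Suc n) \<omega> = k}"
  \<comment> \<open>The total never drops below \<open>T0\<close>, so a sample of \<open>m\<close>
    balls stays possible at each step.\<close>
  have "0 \<le> \<sigma> * int n"
    using assms(2) by simp
  then have t: "t \<ge> int m"
    using assms(3) unfolding t_def by linarith
  have t_real: "real_of_int t = real (W0 + B0) + real_of_int \<sigma> * real n"
    by (simp add: t_def)
  have A: "?A k \<in> sets M" for k
    using measurable_sets[OF draw_measurable[of "Suc n"], of "{k}"]
    by (simp add: vimage_def Int_def conj_commute)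
  have a_eq: "real_of_int (a (m - k)) = real_of_int (a m) + \<beta> * real k" if "k \<le> m" for k
    unfolding affine_urn_reflect[OF assms(5) that] \<beta>_def by simp
  \<comment> \<open>The increment is split according to the value of the draw, so that probabilities
    of single values appear.\<close>
  have "expectation (\<lambda>\<omega>. real_of_int (a (m - X (Suc n) \<omega>)))
      = expectation (\<lambda>\<omega>. \<Sum>k\<le>m. (real_of_int (a m) + \<beta> * real k) * indicator (?A k) \<omega>)"
  proof (rule Bochner_Integration.integral_cong)
    fix \<omega> assume \<omega>: "\<omega> \<in> space M"
    have le: "X (Suc n) \<omega> \<le> m"
      using draw_le[of "Suc n" \<omega>] \<omega> by simp
    have "(\<Sum>k\<le>m. (real_of_int (a m) + \<beta> * real k) * indicator (?A k) \<omega>)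
        = (\<Sum>k\<le>m. if X (Suc n) \<omega> = k then real_of_int (a m) + \<beta> * real k else 0)"
      using \<omega> by (intro sum.cong) (auto simp: indicator_def)
    then show "real_of_int (a (m - X (Suc n) \<omega>))
        = (\<Sum>k\<le>m. (real_of_int (a m) + \<beta> * real k) * indicator (?A k) \<omega>)"
      using le by (simp add: a_eq)
  qed simp
  also have "\<dots> = (\<Sum>k\<le>m. (real_of_int (a m) + \<beta> * real k) * prob (?A k))"
    using A by (subst Bochner_Integration.integral_sum)
      (auto intro!: integrable_mult_right integrable_real_indicator
        simp: emeasure_finite less_top[symmetric] sets.Int_space_eq2)
  also have "\<dots> = (\<Sum>k\<le>m. (real_of_int (a m) + \<beta> * real k)
      * expectation (\<lambda>\<omega>. draw_prob model m t (?W \<omega>) k))"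
    unfolding t_def by (intro sum.cong refl) (simp only: draw_total_prob[OF assms(4)] atMost_iff)
  also have "\<dots> = expectation (\<lambda>\<omega>. \<Sum>k\<le>m. (real_of_int (a m) + \<beta> * real k)
      * draw_prob model m t (?W \<omega>) k)"
    by (subst Bochner_Integration.integral_sum)
      (auto intro!: integrable_mult_right integrable_of_ball_count)
  \<comment> \<open>With the sum back inside the expectation, the mean of a draw is taken pointwise,
    at the current white count.\<close>
  also have "\<dots> = expectation (\<lambda>\<omega>. real_of_int (a m)
      + \<beta> * (real m * real_of_int (?W \<omega>) / real_of_int t))"
    by (simp only: draw_prob_affine_mean[OF assms(1) t])
  also have "\<dots> = real_of_int (a m)
      + \<beta> * real m / real_of_int t * expectation (\<lambda>\<omega>. real_of_int (?W \<omega>))"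
    using integrable_of_ball_count[of real_of_int a W0 n] by (simp add: prob_space)
  finally have step: "expectation (\<lambda>\<omega>. real_of_int (a (m - X (Suc n) \<omega>))) = \<dots>" .
  have "integrable M (\<lambda>\<omega>. real_of_int (a (m - X (Suc n) \<omega>)))"
    by (rule integrable_simple_real[OF simple_function_compose1[OF simple_function_draw]]) simp
  then have "expectation (\<lambda>\<omega>. real_of_int (ball_count m a W0 X (Suc n) \<omega>))
      = expectation (\<lambda>\<omega>. real_of_int (?W \<omega>))
        + expectation (\<lambda>\<omega>. real_of_int (a (m - X (Suc n) \<omega>)))"
    using integrable_of_ball_count[of real_of_int a W0 n]
    by (simp add: ball_count_Suc)
  then show ?thesis
    unfolding step \<beta>_def[symmetric] t_real[symmetric] by (simp add: algebra_simps)
qed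

lemma expectation_ball_count_0:
  "expectation (\<lambda>\<omega>. real_of_int (ball_count m c c0 X 0 \<omega>)) = real c0"
  by (simp add: ball_count_def prob_space)

end

text \<open>Reflection at \<open>k = m\<close> gives \<open>a 0 = a m + \<sigma>\<close>, hence
  \<open>b 0 = - a m\<close>; both models require \<open>a m\<close> and \<open>b 0\<close> to be
  nonnegative.\<close>

lemma balanced_affine_tenable_critical:
  assumes "balanced_urn m a b \<sigma>" and "affine_urn m a" and "tenable_urn model m a b"
    and "int m * (a (m - 1) - a m) = \<sigma>"
  shows "a m = 0"
proof -
  have "a 0 = \<sigma> + a m"
    using affine_urn_reflect[OF assms(2), of m] assms(4) by (simp add: algebra_simps)
  moreover have "a 0 + b 0 = \<sigma>"
    using assms(1) unfolding balanced_urn_def by simp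
  moreover have "a m \<ge> 0 \<and> b 0 \<ge> 0"
    using assms(3) by (cases model) auto
  ultimately show ?thesis
    by linarith
qed

subsection \<open>Solving the recurrence\<close>

lemma urn_g_Suc:
  "urn_g T0 s \<mu> (Suc n) = urn_g T0 s \<mu> n * ((T0 + s * real n) / (T0 + s * real n + \<mu>))"
  by (simp add: urn_g_def)

lemma urn_g_pos:
  assumes "T0 > 0" and "T0 + \<mu> > 0" and "s > 0"
  shows "urn_g T0 s \<mu> n > 0"
  unfolding urn_g_def
proof (intro prod_pos divide_pos_pos)
  fix j
  have "s * real j \<ge> 0"
    using assms by simp
  then show "T0 + s * real j > 0" and "T0 + s * real j + \<mu> > 0"
    using assms by linarith+
qed

lemma urn_g_pochhammer:
  assumes "s > 0"
  shows "urn_g T0 s \<mu> n = pochhammer (T0 / s) n / pochhammer ((T0 + \<mu>) / s) n"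
proof -
  have "x / s + real j = (x + s * real j) / s" for x j
    using assms by (simp add: add_divide_distrib)
  then have "(T0 / s + real j) / ((T0 + \<mu>) / s + real j)
      = (T0 + s * real j) / (T0 + s * real j + \<mu>)" for j
    using assms by (simp add: add_ac)
  then show ?thesis
    unfolding urn_g_def pochhammer_prod prod_dividef[symmetric] atLeast0LessThan by simp
qed

lemma urn_g_Gamma:
  assumes "T0 > 0" and "T0 + \<mu> > 0" and "s > 0"
  shows "urn_g T0 s \<mu> n = Gamma (real n + T0 / s) * Gamma ((T0 + \<mu>) / s)
    / (Gamma (T0 / s) * Gamma (real n + (T0 + \<mu>) / s))"
proof -
  have "T0 / s \<notin> \<int>\<^sub>\<le>\<^sub>0" and "(T0 + \<mu>) / s \<notin> \<int>\<^sub>\<le>\<^sub>0"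
    using assms by (metis add_pos_pos divide_pos_pos nonpos_Ints_nonpos not_less)+
  then show ?thesis
    unfolding urn_g_pochhammer[OF assms(3)] by (simp add: pochhammer_Gamma add_ac)
qed

text \<open>A coefficient \<open>(n - 1 + z) gchoose n\<close> is the rising factorial of
  \<open>z\<close> over \<open>n!\<close>, and the factorials cancel in the quotient.\<close>

lemma urn_g_gbinomial:
  assumes "s > 0"
  shows "1 / urn_g T0 s \<mu> n
    = ((real n - 1 + (T0 + \<mu>) / s) gchoose n) / ((real n - 1 + T0 / s) gchoose n)"
  unfolding urn_g_pochhammer[OF assms] gbinomial_pochhammer' by (simp add: algebra_simps)

text \<open>The recurrence is detached from the process here. The positivity assumptions make every
  factor of \<open>g\<close> positive.\<close>

locale urn_recurrence =
  fixes T0 s \<mu> \<alpha> w0 :: real and E :: "nat \<Rightarrow> real"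
  assumes T0_pos: "T0 > 0" and T0_\<mu>_pos: "T0 + \<mu> > 0" and s_pos: "s > 0"
    and E_0: "E 0 = w0"
    and E_Suc: "E (Suc n) = \<alpha> + (1 + \<mu> / (T0 + s * real n)) * E n"
begin

abbreviation g where "g \<equiv> urn_g T0 s \<mu>"

lemma total_pos: "T0 + s * real n > 0" "T0 + s * real n + \<mu> > 0"
proof -
  have "s * real n \<ge> 0"
    using s_pos by simp
  then show "T0 + s * real n > 0" "T0 + s * real n + \<mu> > 0"
    using T0_pos T0_\<mu>_pos by linarith+
qed

lemma g_pos: "g n > 0"
  using urn_g_pos T0_pos T0_\<mu>_pos s_pos by blast

text \<open>Thus \<open>1 / g\<close> solves the homogeneous recurrence, on which both general
  solutions below rest.\<close>

lemma inverse_g_Suc: "1 / g (Suc n) = (1 + \<mu> / (T0 + s * real n)) * (1 / g n)"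
  using total_pos[of n] g_pos[of n] by (simp add: urn_g_Suc field_simps)

text \<open>Variation of constants: the \<open>\<alpha>\<close> added at step \<open>j\<close> is
  carried to time \<open>n\<close> by the factor \<open>g j / g n\<close>, and \<open>w0\<close> by
  \<open>g 0 / g n\<close> with \<open>g 0 = 1\<close>.\<close>

lemma solution_sum: "E n = \<alpha> / g n * (\<Sum>j=1..n. g j) + w0 / g n"
proof (induction n)
  case 0
  then show ?case
    by (simp add: E_0 urn_g_def)
next
  case (Suc n)
  define q where "q = 1 + \<mu> / (T0 + s * real n)"
  have q: "x / g (Suc n) = q * (x / g n)" for x
    using inverse_g_Suc[of n] unfolding q_def[symmetric]
    by (metis mult.left_commute mult.right_neutral times_divide_eq_right)
  \<comment> \<open>The last summand \<open>g (Suc n)\<close> cancels against the denominator and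
    leaves exactly \<open>\<alpha>\<close>.\<close>
  have "\<alpha> / g (Suc n) * (\<Sum>j=1..Suc n. g j) + w0 / g (Suc n)
      = \<alpha> + (\<alpha> / g (Suc n) * (\<Sum>j=1..n. g j) + w0 / g (Suc n))"
    using g_pos[of "Suc n"] by (simp add: distrib_left)
  also have "\<dots> = \<alpha> + q * E n"
    unfolding q Suc by (simp add: distrib_left mult.assoc)
  finally show ?case
    unfolding E_Suc q_def by simp
qed

text \<open>The particular solution plus a multiple of the homogeneous one; the coefficient of
  \<open>1 / g n\<close> is the deviation of \<open>w0\<close> from the particular solution at
  \<open>n = 0\<close>.\<close>

lemma solution_closed:
  assumes "\<mu> / s < 1"
  shows "E n = \<alpha> * (real n + T0 / s) / (1 - \<mu> / s)
    + (w0 - (\<alpha> * T0 / s) / (1 - \<mu> / s)) * (1 / g n)"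
proof (induction n)
  case 0
  then show ?case
    by (simp add: E_0 urn_g_def)
next
  case (Suc n)
  define c where "c = \<alpha> / (1 - \<mu> / s)"
  define K where "K = w0 - (\<alpha> * T0 / s) / (1 - \<mu> / s)"
  have c: "\<alpha> * x / (1 - \<mu> / s) = c * x" for x
    by (simp add: c_def)
  have "1 - \<mu> / s \<noteq> 0"
    using assms by linarith
  then have \<alpha>: "\<alpha> = c * (1 - \<mu> / s)"
    by (metis c_def nonzero_eq_divide_eq)
  \<comment> \<open>The particular solution is proportional to the total, so the factor
    \<open>\<mu> / (T0 + s * real n)\<close> adds the constant \<open>c * (\<mu> / s)\<close>.
    Together with \<open>\<alpha> = c * (1 - \<mu> / s)\<close> this is the increment
    \<open>c\<close>.\<close>
  have "real n + T0 / s = (T0 + s * real n) / s"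
    using s_pos by (simp add: add_divide_distrib)
  then have "\<mu> / (T0 + s * real n) * (real n + T0 / s) = \<mu> / s"
    using total_pos(1)[of n] by simp
  then have "(1 + \<mu> / (T0 + s * real n)) * (c * (real n + T0 / s))
      = c * (real n + T0 / s) + c * (\<mu> / s)"
    by (metis distrib_right mult.left_commute mult_1)
  moreover have "E n = c * (real n + T0 / s) + K * (1 / g n)"
    using Suc unfolding c K_def .
  ultimately have "E (Suc n) = \<alpha> + c * (real n + T0 / s) + c * (\<mu> / s)
      + K * ((1 + \<mu> / (T0 + s * real n)) * (1 / g n))"
    unfolding E_Suc by (simp only: distrib_left mult.left_commute add.assoc)
  also have "\<dots> = c * (real (Suc n) + T0 / s) + K * (1 / g (Suc n))"
    unfolding inverse_g_Suc \<alpha> by (simp add: algebra_simps)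
  finally show ?case
    unfolding c K_def .
qed

text \<open>For \<open>\<mu> = s\<close> the recurrence factor is the quotient of consecutive
  totals, so the product telescopes.\<close>

lemma solution_critical:
  assumes "\<mu> / s = 1" and "\<alpha> = 0"
  shows "E n = w0 * (real n * s + T0) / T0"
proof (induction n)
  case 0
  then show ?case
    using T0_pos by (simp add: E_0)
next
  case (Suc n)
  define D where "D = T0 + s * real n"
  have "\<mu> = s"
    using assms(1) s_pos by (simp add: field_simps)
  then have "E (Suc n) = (1 + s / D) * (w0 * D / T0)"
    unfolding E_Suc Suc assms(2) D_def by (simp add: mult.commute add.commute)
  also have "\<dots> = w0 * (D + s) / T0"
    using total_pos(1)[of n] T0_pos unfolding D_def[symmetric] by (simp add: field_simps)
  also have "D + s = real (Suc n) * s + T0"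
    by (simp add: D_def algebra_simps)
  finally show ?case .
qed

end

subsection \<open>Asymptotics\<close>

text \<open>Wendel's inequalities: log-convexity of \<open>\<Gamma>\<close> at \<open>y + l = (1 - l) y + l (y + 1)\<close>.\<close>

lemma Gamma_add_le_powr:
  fixes y l :: real
  assumes "y > 0" and "0 < l" and "l < 1"
  shows "Gamma (y + l) \<le> Gamma y * y powr l"
proof -
  have "(ln \<circ> Gamma) ((1 - l) *\<^sub>R y + l *\<^sub>R (y + 1))
      \<le> (1 - l) * (ln \<circ> Gamma) y + l * (ln \<circ> Gamma) (y + 1)"
    using assms by (intro convex_onD[OF log_convex_Gamma_real]) auto
  moreover have "(1 - l) *\<^sub>R y + l *\<^sub>R (y + 1) = y + l"
    by (simp add: algebra_simps)
  moreover have "Gamma (y + 1) = y * Gamma y"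
    using assms by (intro Gamma_plus1) (auto elim!: nonpos_Ints_cases)
  ultimately have "ln (Gamma (y + l)) \<le> (1 - l) * ln (Gamma y) + l * ln (y * Gamma y)"
    by simp
  also have "\<dots> = ln (Gamma y * y powr l)"
    using assms Gamma_real_pos[of y] by (simp add: ln_mult ln_powr algebra_simps)
  finally show ?thesis
    using assms Gamma_real_pos[of y] Gamma_real_pos[of "y + l"] by simp
qed

lemma Gamma_add_ge_powr:
  fixes y l :: real
  assumes "y > 0" and "0 < l" and "l < 1"
  shows "Gamma y * (y * (y + l) powr (l - 1)) \<le> Gamma (y + l)"
proof -
  have "Gamma (y + 1) = y * Gamma y"
    using assms by (intro Gamma_plus1) (auto elim!: nonpos_Ints_cases)
  \<comment> \<open>The upper bound is applied from \<open>y + l\<close> with exponent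
    \<open>1 - l\<close>, which lands on \<open>y + 1\<close>.\<close>
  then have "y * Gamma y \<le> Gamma (y + l) * (y + l) powr (1 - l)"
    using Gamma_add_le_powr[of "y + l" "1 - l"] assms by simp
  then have "y * Gamma y * (y + l) powr (l - 1)
      \<le> Gamma (y + l) * (y + l) powr (1 - l) * (y + l) powr (l - 1)"
    by (rule mult_right_mono) simp
  also have "\<dots> = Gamma (y + l)"
    using assms by (simp add: mult.assoc powr_add[symmetric])
  finally show ?thesis
    by (simp add: mult_ac)
qed

text \<open>Wendel's inequalities place the difference between \<open>v n\<close> and
  \<open>u n\<close>. Both are bounded because, for \<open>l < 1\<close>, constant shifts change
  \<open>n powr l\<close> only by a vanishing amount.\<close>

lemma Gamma_ratio_asymptotics:
  fixes x l :: real
  assumes "x > 0" and "0 < l" and "l < 1"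
  shows "(\<lambda>n. Gamma (real n + x + l) / Gamma (real n + x) - real n powr l) \<in> O(\<lambda>_. 1)"
proof -
  define u where "u = (\<lambda>n. (real n + x) powr l - real n powr l)"
  define v where "v = (\<lambda>n. (real n + x) * (real n + x + l) powr (l - 1) - real n powr l)"
  have "u \<in> O(\<lambda>_. 1)" and "v \<in> O(\<lambda>_. 1)"
    unfolding u_def v_def using assms by real_asymp+
  then have uv: "(\<lambda>n. \<bar>u n\<bar> + \<bar>v n\<bar>) \<in> O(\<lambda>_. 1)"
    by (intro sum_in_bigo) auto
  have "norm (Gamma (real n + x + l) / Gamma (real n + x) - real n powr l)
      \<le> norm (\<bar>u n\<bar> + \<bar>v n\<bar>)" for n
  proof -
    have "real n + x > 0" and "Gamma (real n + x) > 0"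
      using assms by (auto intro!: Gamma_real_pos add_nonneg_pos)
    then have "Gamma (real n + x + l) / Gamma (real n + x) \<le> (real n + x) powr l"
      and "(real n + x) * (real n + x + l) powr (l - 1)
        \<le> Gamma (real n + x + l) / Gamma (real n + x)"
      using Gamma_add_le_powr[of "real n + x" l] Gamma_add_ge_powr[of "real n + x" l] assms
      by (simp_all add: field_simps)
    then have "Gamma (real n + x + l) / Gamma (real n + x) - real n powr l \<le> u n"
      and "v n \<le> Gamma (real n + x + l) / Gamma (real n + x) - real n powr l"
      unfolding u_def v_def by linarith+
    then show ?thesis
      unfolding real_norm_def by linarith
  qed
  then show ?thesis
    by (intro landau_o.big_trans[OF _ uv] landau_o.bigI[of 1]) auto
qed

context urn_recurrence
begin

text \<open>The split on the sign of \<open>\<mu>\<close> reflects the range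
  \<open>0 < l < 1\<close> of the Gamma estimate.\<close>

lemma inverse_g_asymptotics:
  assumes "\<mu> / s < 1"
  shows "(\<lambda>n. 1 / g n - Gamma (T0 / s) / Gamma ((T0 + \<mu>) / s) * real n powr (\<mu> / s)) \<in> O(\<lambda>_. 1)"
proof (cases "\<mu> > 0")
  case True
  define C where "C = Gamma (T0 / s) / Gamma ((T0 + \<mu>) / s)"
  have "1 / g n = C * (Gamma (real n + T0 / s + \<mu> / s) / Gamma (real n + T0 / s))" for n
    unfolding urn_g_Gamma[OF T0_pos T0_\<mu>_pos s_pos] C_def by (simp add: add_divide_distrib add_ac)
  then have "(\<lambda>n. 1 / g n - C * real n powr (\<mu> / s))
      = (\<lambda>n. C * (Gamma (real n + T0 / s + \<mu> / s) / Gamma (real n + T0 / s) - real n powr (\<mu> / s)))"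
    by (simp add: right_diff_distrib)
  then show ?thesis
    using Gamma_ratio_asymptotics[of "T0 / s" "\<mu> / s"] True assms T0_pos s_pos
    unfolding C_def[symmetric] by simp
next
  case False
  \<comment> \<open>Both terms are bounded, so no estimate of their difference is needed.\<close>
  have "1 / g n \<le> 1" for n
  proof (induction n)
    case 0
    then show ?case
      by (simp add: urn_g_def)
  next
    case (Suc n)
    have "1 + \<mu> / (T0 + s * real n) \<le> 1"
      using False total_pos[of n] by (simp add: divide_nonpos_pos)
    then have "(1 + \<mu> / (T0 + s * real n)) * (1 / g n) \<le> 1 * (1 / g n)"
      using g_pos[of n] by (intro mult_right_mono) auto
    then show ?case
      unfolding inverse_g_Suc using Suc by linarith
  qed
  then have g: "(\<lambda>n. 1 / g n) \<in> O(\<lambda>_. 1)"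
    using g_pos by (intro landau_o.bigI[of 1]) (auto simp: less_imp_le)
  \<comment> \<open>Monotonicity in the exponent needs a base of at least 1; at \<open>n = 0\<close>
    the power is 0 by convention.\<close>
  have "real n powr (\<mu> / s) \<le> 1" for n
  proof (cases n)
    case (Suc k)
    then have "real n powr (\<mu> / s) \<le> real n powr 0"
      using False s_pos by (intro powr_mono) (auto simp: divide_nonpos_pos)
    then show ?thesis
      using Suc by simp
  qed simp
  then have "(\<lambda>n. real n powr (\<mu> / s)) \<in> O(\<lambda>_. 1)"
    by (intro landau_o.bigI[of 1]) auto
  then show ?thesis
    by (intro sum_in_bigo(2)[OF g]) (simp only: cmult_in_bigo_iff simp_thms)
qed

text \<open>In the closed form the constant \<open>c * (T0 / s)\<close> and \<open>K\<close> times
  the error of \<open>1 / g n\<close> are both bounded.\<close>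

lemma solution_asymptotics:
  assumes "\<mu> / s < 1"
  shows "(\<lambda>n. E n - (\<alpha> * s / (s - \<mu>) * real n
      + (w0 - (\<alpha> * T0 / s) / (1 - \<mu> / s))
        * (Gamma (T0 / s) / Gamma ((T0 + \<mu>) / s)) * real n powr (\<mu> / s))) \<in> O(\<lambda>_. 1)"
proof -
  define c where "c = \<alpha> / (1 - \<mu> / s)"
  define K where "K = w0 - (\<alpha> * T0 / s) / (1 - \<mu> / s)"
  define C where "C = Gamma (T0 / s) / Gamma ((T0 + \<mu>) / s)"
  have c: "\<alpha> * s / (s - \<mu>) = c"
    using s_pos assms unfolding c_def by (simp add: field_simps)
  have "E n = c * (real n + T0 / s) + K * (1 / g n)" for n
    using solution_closed[OF assms, of n] unfolding c_def K_def by simp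
  then have "(\<lambda>n. E n - (c * real n + K * C * real n powr (\<mu> / s)))
      = (\<lambda>n. c * (T0 / s) + K * (1 / g n - C * real n powr (\<mu> / s)))"
    by (simp add: algebra_simps)
  moreover have "\<dots> \<in> O(\<lambda>_. 1)"
    using inverse_g_asymptotics[OF assms] unfolding C_def[symmetric]
    by (intro sum_in_bigo(1)) (simp_all only: cmult_in_bigo_iff bigo_const simp_thms)
  ultimately show ?thesis
    unfolding c K_def C_def by simp
qed

end

section \<open>From the urn process to the abstract recurrence\<close>

theorem proposition2:
  fixes M :: "'w measure"
    and model :: sampling_model
    and m W0 B0 :: nat
    and \<sigma> :: int
    and a b :: "nat \<Rightarrow> int"
    and X :: "nat \<Rightarrow> 'w \<Rightarrow> nat"
    and T0 s \<mu> am w0 :: real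
    and g EW :: "nat \<Rightarrow> real"
  assumes "m \<ge> 1" and "\<sigma> \<ge> 1" and "W0 + B0 \<ge> m"
    and "balanced_urn m a b \<sigma>"
    and "tenable_urn model m a b"
    and "affine_urn m a"
    and "urn_process M model m a b W0 B0 X"
    and T0: "T0 = real (W0 + B0)"
    and s: "s = real_of_int \<sigma>"
    and \<mu>: "\<mu> = real m * real_of_int (a (m - 1) - a m)"
    and am: "am = real_of_int (a m)"
    and w0: "w0 = real W0"
    and g: "g = urn_g T0 s \<mu>"
    and EW: "EW = (\<lambda>n. integral\<^sup>L M (\<lambda>\<omega>. real_of_int (ball_count m a W0 X n \<omega>)))"
    and "T0 + \<mu> > 0"
  shows "(\<forall>n. g n = Gamma (real n + T0 / s) * Gamma ((T0 + \<mu>) / s)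
                 / (Gamma (T0 / s) * Gamma (real n + (T0 + \<mu>) / s)))
    \<and> (\<forall>n. EW n = am / g n * (\<Sum>j=1..n. g j) + w0 / g n)
    \<and> (\<mu> / s < 1 \<longrightarrow>
        (\<forall>n. EW n = am * (real n + T0 / s) / (1 - \<mu> / s)
            + (w0 - (am * T0 / s) / (1 - \<mu> / s))
              * ((real n - 1 + (T0 + \<mu>) / s) gchoose n) / ((real n - 1 + T0 / s) gchoose n))
        \<and> (\<lambda>n. EW n - (am * s / (s - \<mu>) * real n
            + (w0 - (am * T0 / s) / (1 - \<mu> / s))
              * (Gamma (T0 / s) / Gamma ((T0 + \<mu>) / s)) * real n powr (\<mu> / s))) \<in> O(\<lambda>_. 1))
    \<and> (\<mu> / s = 1 \<longrightarrow> (\<forall>n. EW n = w0 * (real n * s + T0) / T0))"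
proof -
  interpret urn_process M model m a b W0 B0 X
    by fact
  have E_Suc: "EW (Suc n) = am + (1 + \<mu> / (T0 + s * real n)) * EW n" for n
    unfolding EW am \<mu> T0 s by (rule expectation_ball_count_Suc) fact+
  interpret urn_recurrence T0 s \<mu> am w0 EW
  proof
    show "T0 > 0" and "s > 0"
      using assms(1-3) by (simp_all add: T0 s)
    show "EW 0 = w0"
      unfolding EW w0 by (rule expectation_ball_count_0)
  qed (fact E_Suc assms)+
  have am_0: "am = 0" if "\<mu> / s = 1"
  proof -
    have "\<mu> = s"
      using that s_pos by (simp add: field_simps)
    \<comment> \<open>Both sides of \<open>\<mu> = s\<close> are images of integers, so the equation
      transfers back to the integers, where balance and tenability are stated.\<close>
    then have "int m * (a (m - 1) - a m) = \<sigma>"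
      unfolding \<mu> s by (metis of_int_eq_iff of_int_mult of_int_of_nat_eq)
    then show ?thesis
      using balanced_affine_tenable_critical assms(4-6) by (simp add: am)
  qed
  \<comment> \<open>Rewriting \<open>1 / g n\<close> by binomial coefficients and moving the
    division outward gives the closed form the shape of the goal.\<close>
  show ?thesis
    unfolding g
    using urn_g_Gamma[OF T0_pos T0_\<mu>_pos s_pos] solution_sum solution_asymptotics
      solution_closed[unfolded urn_g_gbinomial[OF s_pos] times_divide_eq_right]
      solution_critical am_0
    by blast
qed

end
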